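(* Let $k\geq 1$ and let $X$ be a pure $k$-dimensional simplicial complex on a finite vertex set $V$. Then (1) $\hat{\vartheta}_\ell(X)\leq \vartheta_\ell(X)$ for every integer $\ell$ with $k\leq\ell\leq\alpha(X)$; and (2) $\alpha(X)=\hat{\vartheta}_{\alpha(X)}(X)\leq \hat{\vartheta}_{\alpha(X)-1}(X)\leq\dots\leq \hat{\vartheta}_k(X)$.
   Context: A simplicial complex on $V$ is a family of subsets of $V$ (faces) closed under subsets; $X_i$ is the set of faces with $i+1$ elements; $X$ is pure of dimension $k$ if every inclusion-maximal face has $k+1$ elements. An independent set is a subset of $V$ containing no element of $X_k$; $\alpha(X)$ is the maximum size of an independent set; $\operatorname{Ind}_i$ is the set of independent sets with $i+1$ elements ($i\geq 0$). Fix a total order on $V$; for $F=\{x_0<\dots<x_i\}$ and $K\subset F$ with $F\setminus K=\{x_j\}$ set $[F:K]=(-1)^j$; for distinct equal-size $F,F'$ with $|F\cap F'|=|F|-1$ put $\epsilon_{F,F'}=[F:F\cap F'][F':F\cap F']$, otherwise $\epsilon_{F,F'}=0$. For $j\geq 0$, let $\mathcal{Y}_j$ be the set of real symmetric matrices $Y$ indexed by $\operatorname{Ind}_j$ such that $Y_{F,F'}=0$ whenever $F\cup F'$ is a $(j+2)$-subset of $V$ not in $\operatorname{Ind}_{j+1}$, $Y_{F,F'}=0$ whenever $|F\cup F'|\geq j+3$, and $\epsilon_{F,F'}Y_{F,F'}=\epsilon_{F'',F^\dagger}Y_{F'',F^\dagger}$ whenever $F\cup F'=F''\cup F^\dagger$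 has $j+2$ elements. Such $Y$ corresponds bijectively to $y\in\mathbb{R}^{\operatorname{Ind}_j\cup\operatorname{Ind}_{j+1}}$ via $y(F)=Y_{F,F}$ for $F\in\operatorname{Ind}_j$ and $y(H)=\epsilon_{F,F'}Y_{F,F'}$ for $H\in\operatorname{Ind}_{j+1}$ and any distinct $F,F'\in\operatorname{Ind}_j$ with $F\cup F'=H$. For $j\geq 1$ define $\tau_j:\mathcal{Y}_j\to\mathcal{Y}_{j-1}$ by $\tau_j(y)=z$ with $z(K)=\frac{1}{j+1}\sum_{F\in\operatorname{Ind}_j,\,K\subset F}y(F)$ for $K\in\operatorname{Ind}_{j-1}$ and $z(F)=\frac{1}{(j+1)j}y(F)+\frac{1}{j}\sum_{H\in\operatorname{Ind}_{j+1},\,F\subset H}y(H)$ for $F\in\operatorname{Ind}_j$. For $k\leq\ell\leq\alpha(X)$, let $L^{\downarrow}_{\ell-1}(\operatorname{Ind})$ be the matrix indexed by $\operatorname{Ind}_{\ell-1}$ with diagonal entries $\ell$ and off-diagonal entries $\epsilon_{F,F'}$. Define $\vartheta_\ell(X)$ as the supremum of $\operatorname{trace}(L^{\downarrow}_{\ell-1}(\operatorname{Ind})Y)$ over positive semidefinite $Y\in\mathcal{Y}_{\ell-1}$ with $\operatorname{trace}(Y)=1$, and $\hat{\vartheta}_\ell(X)$ as the same supremum with the additional constraints $\tau_i\circ\tau_{i+1}\circ\dots\circ\tau_{\ell-1}(Y)\succeq 0$ for all $i=1,\dots,\ell-1$. *)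

theory Defs
  imports "HOL-Analysis.Analysis"
begin

definition simplicial_complex_on :: "'v set \<Rightarrow> 'v set set \<Rightarrow> bool" where
  "simplicial_complex_on V X \<longleftrightarrow> (\<forall>F\<in>X. F \<subseteq> V \<and> (\<forall>K. K \<subseteq> F \<longrightarrow> K \<in> X))"

definition faces :: "'v set set \<Rightarrow> nat \<Rightarrow> 'v set set" where
  "faces X i = {F \<in> X. finite F \<and> card F = i + 1}"

(* Nonemptiness excludes the void complex, for which the condition on maximal
   faces is vacuous although it has no k-dimensional face. *)
definition pure_of_dim :: "nat \<Rightarrow> 'v set set \<Rightarrow> bool" where
  "pure_of_dim k X \<longleftrightarrow>
     X \<noteq> {} \<and> (\<forall>F\<in>X. (\<forall>G\<in>X. F \<subseteq> G \<longrightarrow> G = F) \<longrightarrow> card F = k + 1)"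

definition independent_set :: "'v set \<Rightarrow> 'v set set \<Rightarrow> nat \<Rightarrow> 'v set \<Rightarrow> bool" where
  "independent_set V X k A \<longleftrightarrow> A \<subseteq> V \<and> (\<forall>F\<in>faces X k. \<not> F \<subseteq> A)"

definition indep_number :: "'v set \<Rightarrow> 'v set set \<Rightarrow> nat \<Rightarrow> nat" where
  "indep_number V X k = Max {card A |A. independent_set V X k A}"

definition Ind :: "'v set \<Rightarrow> 'v set set \<Rightarrow> nat \<Rightarrow> nat \<Rightarrow> 'v set set" where
  "Ind V X k i = {A. independent_set V X k A \<and> card A = i + 1}"

(* If F = {x_0 < ... < x_i} and F - K = {x_j}, then j is the number of elements
   of F below x_j.  Only used for K \<subset> F with F - K a singleton. *)
definition incidence :: "'v::linorder set \<Rightarrow> 'v set \<Rightarrow> real" where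
  "incidence F K = (- 1) ^ card {y \<in> F. y < the_elem (F - K)}"

definition eps :: "'v::linorder set \<Rightarrow> 'v set \<Rightarrow> real" where
  "eps F F' =
     (if F \<noteq> F' \<and> card F = card F' \<and> card (F \<inter> F') = card F - 1
      then incidence F (F \<inter> F') * incidence F' (F \<inter> F') else 0)"


(* A real matrix indexed by a finite set I is a function I \<Rightarrow> I \<Rightarrow> real; outside I
   the values do not affect mat_trace and pos_semidef. *)

definition mat_mult :: "'i set \<Rightarrow> ('i \<Rightarrow> 'i \<Rightarrow> real) \<Rightarrow> ('i \<Rightarrow> 'i \<Rightarrow> real) \<Rightarrow> 'i \<Rightarrow> 'i \<Rightarrow> real" where
  "mat_mult I A B = (\<lambda>i j. \<Sum>m\<in>I. A i m * B m j)"

definition mat_trace :: "'i set \<Rightarrow> ('i \<Rightarrow> 'i \<Rightarrow> real) \<Rightarrow> real" where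
  "mat_trace I A = (\<Sum>i\<in>I. A i i)"

definition pos_semidef :: "'i set \<Rightarrow> ('i \<Rightarrow> 'i \<Rightarrow> real) \<Rightarrow> bool" where
  "pos_semidef I A \<longleftrightarrow>
     (\<forall>i\<in>I. \<forall>j\<in>I. A i j = A j i) \<and>
     (\<forall>x :: 'i \<Rightarrow> real. 0 \<le> (\<Sum>i\<in>I. \<Sum>j\<in>I. x i * A i j * x j))"


(* The first condition (zero outside Ind_j) only selects the canonical function
   representing a matrix indexed by Ind_j. *)
definition Ymats ::
  "'v::linorder set \<Rightarrow> 'v set set \<Rightarrow> nat \<Rightarrow> nat \<Rightarrow> ('v set \<Rightarrow> 'v set \<Rightarrow> real) set" where
  "Ymats V X k j = {Y.
     (\<forall>F F'. F \<notin> Ind V X k j \<or> F' \<notin> Ind V X k j \<longrightarrow> Y F F' = 0) \<and>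
     (\<forall>F\<in>Ind V X k j. \<forall>F'\<in>Ind V X k j. Y F F' = Y F' F) \<and>
     (\<forall>F\<in>Ind V X k j. \<forall>F'\<in>Ind V X k j.
        card (F \<union> F') = j + 2 \<and> F \<union> F' \<notin> Ind V X k (j + 1) \<longrightarrow> Y F F' = 0) \<and>
     (\<forall>F\<in>Ind V X k j. \<forall>F'\<in>Ind V X k j. j + 3 \<le> card (F \<union> F') \<longrightarrow> Y F F' = 0) \<and>
     (\<forall>F\<in>Ind V X k j. \<forall>F'\<in>Ind V X k j. \<forall>G\<in>Ind V X k j. \<forall>G'\<in>Ind V X k j.
        F \<union> F' = G \<union> G' \<and> card (F \<union> F') = j + 2 \<longrightarrow>
        eps F F' * Y F F' = eps G G' * Y G G')}"

definition Yvecs ::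
  "'v::linorder set \<Rightarrow> 'v set set \<Rightarrow> nat \<Rightarrow> nat \<Rightarrow> ('v set \<Rightarrow> real) set" where
  "Yvecs V X k j = {y. \<forall>G. G \<notin> Ind V X k j \<union> Ind V X k (j + 1) \<longrightarrow> y G = 0}"

definition vec_of_mat ::
  "'v::linorder set \<Rightarrow> 'v set set \<Rightarrow> nat \<Rightarrow> nat \<Rightarrow>
   ('v set \<Rightarrow> 'v set \<Rightarrow> real) \<Rightarrow> 'v set \<Rightarrow> real" where
  "vec_of_mat V X k j Y = (\<lambda>G.
     if G \<in> Ind V X k j then Y G G
     else if G \<in> Ind V X k (j + 1) then
       (THE r. \<forall>F\<in>Ind V X k j. \<forall>F'\<in>Ind V X k j.
          F \<noteq> F' \<and> F \<union> F' = G \<longrightarrow> r = eps F F' * Y F F')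
     else 0)"

(* Inverse of vec_of_mat; since eps = \<plusminus>1 here, y(H) = eps * Y is the same as Y = eps * y(H). *)
definition mat_of_vec ::
  "'v::linorder set \<Rightarrow> 'v set set \<Rightarrow> nat \<Rightarrow> nat \<Rightarrow>
   ('v set \<Rightarrow> real) \<Rightarrow> 'v set \<Rightarrow> 'v set \<Rightarrow> real" where
  "mat_of_vec V X k j y = (\<lambda>F F'.
     if F \<in> Ind V X k j \<and> F' \<in> Ind V X k j then
       (if F = F' then y F
        else if F \<union> F' \<in> Ind V X k (j + 1) then eps F F' * y (F \<union> F')
        else 0)
     else 0)"

lemma eps_sym: "eps F F' = eps F' F"
proof -
  have "F' \<inter> F = F \<inter> F'" by blast
  then show ?thesis unfolding eps_def by (metis mult.commute)
qed

lemma eps_square: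
  assumes "F \<noteq> F'" "card F = j + 1" "card F' = j + 1" "card (F \<union> F') = j + 2"
  shows "eps F F' * eps F F' = 1"
proof -
  have fin: "finite F" "finite F'" using assms(2,3) by (auto intro: card_ge_0_finite)
  have "card F + card F' = card (F \<union> F') + card (F \<inter> F')" using fin by (rule card_Un_Int)
  then have "card (F \<inter> F') = j" using assms by simp
  then have "eps F F' = incidence F (F \<inter> F') * incidence F' (F \<inter> F')"
    using assms unfolding eps_def by simp
  moreover have "incidence A B * incidence A B = 1" for A B :: "'a set"
    unfolding incidence_def by (simp flip: power_mult_distrib)
  ultimately show ?thesis by (simp add: algebra_simps)
qed

lemma Ind_Un_cover:
  assumes "H \<in> Ind V X k (j + 1)"
  shows "\<exists>F\<in>Ind V X k j. \<exists>F'\<in>Ind V X k j. F \<noteq> F' \<and> F \<union> F' = H"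
proof -
  have H: "independent_set V X k H" "card H = j + 2" using assms by (auto simp: Ind_def)
  then have fin: "finite H" by (auto intro: card_ge_0_finite)
  obtain a where a: "a \<in> H" using H by fastforce
  have "card (H - {a}) = j + 1" using H a fin by simp
  then obtain b where b: "b \<in> H - {a}" by (metis card.empty add_is_0 one_neq_zero ex_in_conv)
  have 1: "H - {c} \<in> Ind V X k j" if "c \<in> H" for c
    using that H fin unfolding Ind_def independent_set_def by auto
  have "H - {a} \<noteq> H - {b}" "(H - {a}) \<union> (H - {b}) = H" using a b by auto
  then show ?thesis using 1[of a] 1[of b] a b by (metis DiffD1)
qed

lemma vec_of_mat_Suc:
  assumes Y: "Y \<in> Ymats V X k j" and FF: "F \<in> Ind V X k j" "F' \<in> Ind V X k j" "F \<noteq> F'"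
    and H: "F \<union> F' \<in> Ind V X k (j + 1)"
  shows "vec_of_mat V X k j Y (F \<union> F') = eps F F' * Y F F'"
proof -
  have c: "card (F \<union> F') = j + 2" using H by (simp add: Ind_def)
  then have "F \<union> F' \<notin> Ind V X k j" by (simp add: Ind_def)
  moreover have "(THE r. \<forall>G\<in>Ind V X k j. \<forall>G'\<in>Ind V X k j.
          G \<noteq> G' \<and> G \<union> G' = F \<union> F' \<longrightarrow> r = eps G G' * Y G G') = eps F F' * Y F F'"
  proof (rule the_equality)
    show "\<forall>G\<in>Ind V X k j. \<forall>G'\<in>Ind V X k j.
          G \<noteq> G' \<and> G \<union> G' = F \<union> F' \<longrightarrow> eps F F' * Y F F' = eps G G' * Y G G'"
    proof (intro ballI impI)
      fix G G' assume "G \<in> Ind V X k j" "G' \<in> Ind V X k j" "G \<noteq> G' \<and> G \<union> G' = F \<union> F'"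
      then show "eps F F' * Y F F' = eps G G' * Y G G'"
        using Y FF c unfolding Ymats_def mem_Collect_eq by metis
    qed
  qed (use FF in blast)
  ultimately show ?thesis using H by (simp add: vec_of_mat_def)
qed

lemma mat_of_vec_in_Ymats: "mat_of_vec V X k j y \<in> Ymats V X k j"
proof -
  have sq: "eps F F' * (eps F F' * c) = c"
    if "F \<in> Ind V X k j" "F' \<in> Ind V X k j" "F \<noteq> F'" "F \<union> F' \<in> Ind V X k (j + 1)" for F F' c
  proof -
    have "eps F F' * eps F F' = 1"
      by (rule eps_square[of _ _ j]) (use that in \<open>auto simp: Ind_def\<close>)
    then show ?thesis by (simp flip: mult.assoc)
  qed
  have one: "F \<noteq> F'" if "F \<in> Ind V X k j" "j + 2 \<le> card (F \<union> F')" for F F'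
    using that by (auto simp: Ind_def)
  have two: "F \<union> F' \<notin> Ind V X k (j + 1)" if "j + 3 \<le> card (F \<union> F')" for F F'
    using that by (auto simp: Ind_def)
  have 4: "eps F F' * mat_of_vec V X k j y F F' =
       (if F \<union> F' \<in> Ind V X k (j + 1) then y (F \<union> F') else 0)"
    if "F \<in> Ind V X k j" "F' \<in> Ind V X k j" "card (F \<union> F') = j + 2" for F F'
    using that sq[OF that(1,2)] one[of F F'] by (auto simp: mat_of_vec_def)
  have c1: "mat_of_vec V X k j y F F' = mat_of_vec V X k j y F' F" for F F'
    by (auto simp: mat_of_vec_def eps_sym[of F F'] Un_commute)
  have c2: "mat_of_vec V X k j y F F' = 0"
    if "F \<in> Ind V X k j" "F' \<in> Ind V X k j" "card (F \<union> F') = j + 2" "F \<union> F' \<notin> Ind V X k (j + 1)" for F F'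
    using that one[of F F'] by (auto simp: mat_of_vec_def)
  have c3: "mat_of_vec V X k j y F F' = 0"
    if "F \<in> Ind V X k j" "F' \<in> Ind V X k j" "j + 3 \<le> card (F \<union> F')" for F F'
    using that one[of F F'] two[of F F'] by (auto simp: mat_of_vec_def)
  have c4: "mat_of_vec V X k j y F F' = 0"
    if "F \<notin> Ind V X k j \<or> F' \<notin> Ind V X k j" for F F'
    using that by (auto simp: mat_of_vec_def)
  have c5: "eps F F' * mat_of_vec V X k j y F F' = eps G G' * mat_of_vec V X k j y G G'"
    if "F \<in> Ind V X k j" "F' \<in> Ind V X k j" "G \<in> Ind V X k j" "G' \<in> Ind V X k j"
       "F \<union> F' = G \<union> G'" "card (F \<union> F') = j + 2" for F F' G G'
    using 4[of F F'] 4[of G G'] that by simp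
  show ?thesis
    unfolding Ymats_def mem_Collect_eq
  proof (intro conjI ballI allI impI, goal_cases)
    case (1 F F') then show ?case by (rule c4)
  next
    case (2 F F') then show ?case by (intro c1)
  next
    case (3 F F') then show ?case by (intro c2) auto
  next
    case (4 F F') then show ?case by (intro c3)
  next
    case (5 F F' G G') then show ?case by (intro c5) auto
  qed
qed

lemma bij_betw_vec_of_mat:
  "bij_betw (vec_of_mat V X k j) (Ymats V X k j) (Yvecs V X k j)"
  "Y \<in> Ymats V X k j \<Longrightarrow> mat_of_vec V X k j (vec_of_mat V X k j Y) = Y"
proof -
  show inv: "mat_of_vec V X k j (vec_of_mat V X k j Y) = Y" if Y: "Y \<in> Ymats V X k j" for Y
  proof (intro ext)
    fix F F'
    show "mat_of_vec V X k j (vec_of_mat V X k j Y) F F' = Y F F'"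
    proof (cases "F \<in> Ind V X k j \<and> F' \<in> Ind V X k j")
      case False
      then show ?thesis using Y by (auto simp: mat_of_vec_def Ymats_def)
    next
      case True
      then have F: "F \<in> Ind V X k j" "F' \<in> Ind V X k j" by auto
      consider "F = F'" | "F \<noteq> F'" "F \<union> F' \<in> Ind V X k (j + 1)"
        | "F \<noteq> F'" "F \<union> F' \<notin> Ind V X k (j + 1)" by blast
      then show ?thesis
      proof cases
        case 1
        then show ?thesis using F by (simp add: mat_of_vec_def vec_of_mat_def)
      next
        case 2
        have "eps F F' * eps F F' = 1"
          by (rule eps_square[of _ _ j]) (use F 2 in \<open>auto simp: Ind_def\<close>)
        then show ?thesis using F 2 vec_of_mat_Suc[OF Y F 2]
          by (simp add: mat_of_vec_def flip: mult.assoc)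
      next
        case 3
        have fin: "finite F" "finite F'"
          using F by (auto simp: Ind_def intro: card_ge_0_finite)
        have "F \<subset> F \<union> F'"
          using 3 F fin card_subset_eq[of F F'] by (auto simp: Ind_def)
        then have "card F < card (F \<union> F')" using fin by (simp add: psubset_card_mono)
        then have "card (F \<union> F') = j + 2 \<or> j + 3 \<le> card (F \<union> F')" using F by (auto simp: Ind_def)
        then have "Y F F' = 0" using Y F 3 unfolding Ymats_def mem_Collect_eq by metis
        then show ?thesis using F 3 by (simp add: mat_of_vec_def)
      qed
    qed
  qed
  have inv': "vec_of_mat V X k j (mat_of_vec V X k j y) = y" if y: "y \<in> Yvecs V X k j" for y
  proof
    fix H
    consider "H \<in> Ind V X k j" | "H \<in> Ind V X k (j + 1)" "H \<notin> Ind V X k j"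
      | "H \<notin> Ind V X k j" "H \<notin> Ind V X k (j + 1)" by blast
    then show "vec_of_mat V X k j (mat_of_vec V X k j y) H = y H"
    proof cases
      case 1
      then show ?thesis by (simp add: vec_of_mat_def mat_of_vec_def)
    next
      case 2
      obtain F F' where F: "F \<in> Ind V X k j" "F' \<in> Ind V X k j" "F \<noteq> F'" "F \<union> F' = H"
        using Ind_Un_cover[OF 2(1)] by blast
      have "eps F F' * eps F F' = 1"
        by (rule eps_square[of _ _ j]) (use F 2 in \<open>auto simp: Ind_def\<close>)
      then show ?thesis
        using vec_of_mat_Suc[OF mat_of_vec_in_Ymats F(1-3), of y] F 2
        by (simp add: mat_of_vec_def flip: mult.assoc)
    next
      case 3
      then show ?thesis using y by (simp add: vec_of_mat_def Yvecs_def)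
    qed
  qed
  show "bij_betw (vec_of_mat V X k j) (Ymats V X k j) (Yvecs V X k j)"
    by (rule bij_betw_byWitness[where f' = "mat_of_vec V X k j"])
       (use inv inv' mat_of_vec_in_Ymats in \<open>auto simp: Yvecs_def vec_of_mat_def\<close>)
qed

definition tau_vec ::
  "'v::linorder set \<Rightarrow> 'v set set \<Rightarrow> nat \<Rightarrow> nat \<Rightarrow> ('v set \<Rightarrow> real) \<Rightarrow> 'v set \<Rightarrow> real" where
  "tau_vec V X k j y = (\<lambda>G.
     if G \<in> Ind V X k (j - 1) then
       1 / real (j + 1) * (\<Sum>F | F \<in> Ind V X k j \<and> G \<subset> F. y F)
     else if G \<in> Ind V X k j then
       1 / real ((j + 1) * j) * y G
       + 1 / real j * (\<Sum>H | H \<in> Ind V X k (j + 1) \<and> G \<subset> H. y H)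
     else 0)"

(* Maps Ymats V X k j to Ymats V X k (j - 1), for j \<ge> 1. *)
definition tau ::
  "'v::linorder set \<Rightarrow> 'v set set \<Rightarrow> nat \<Rightarrow> nat \<Rightarrow>
   ('v set \<Rightarrow> 'v set \<Rightarrow> real) \<Rightarrow> 'v set \<Rightarrow> 'v set \<Rightarrow> real" where
  "tau V X k j Y = mat_of_vec V X k (j - 1) (tau_vec V X k j (vec_of_mat V X k j Y))"


definition Ldown :: "nat \<Rightarrow> 'v::linorder set \<Rightarrow> 'v set \<Rightarrow> real" where
  "Ldown l F F' = (if F = F' then real l else eps F F')"

definition theta_feasible ::
  "'v::linorder set \<Rightarrow> 'v set set \<Rightarrow> nat \<Rightarrow> nat \<Rightarrow> ('v set \<Rightarrow> 'v set \<Rightarrow> real) set" where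
  "theta_feasible V X k l = {Y \<in> Ymats V X k (l - 1).
     pos_semidef (Ind V X k (l - 1)) Y \<and> mat_trace (Ind V X k (l - 1)) Y = 1}"

(* The foldr is tau_i (tau_{i+1} (... (tau_{l-1} Y))). *)
definition theta_hat_feasible ::
  "'v::linorder set \<Rightarrow> 'v set set \<Rightarrow> nat \<Rightarrow> nat \<Rightarrow> ('v set \<Rightarrow> 'v set \<Rightarrow> real) set" where
  "theta_hat_feasible V X k l = {Y \<in> theta_feasible V X k l.
     \<forall>i\<in>{1..l - 1}. pos_semidef (Ind V X k (i - 1)) (foldr (tau V X k) [i..<l] Y)}"

definition objective ::
  "'v::linorder set \<Rightarrow> 'v set set \<Rightarrow> nat \<Rightarrow> nat \<Rightarrow> ('v set \<Rightarrow> 'v set \<Rightarrow> real) \<Rightarrow> real" where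
  "objective V X k l Y =
     mat_trace (Ind V X k (l - 1)) (mat_mult (Ind V X k (l - 1)) (Ldown l) Y)"

(* For k \<le> l \<le> alpha(X), k \<ge> 1, both feasible sets are nonempty and compact, so the
   real suprema below are genuine. *)
definition theta :: "'v::linorder set \<Rightarrow> 'v set set \<Rightarrow> nat \<Rightarrow> nat \<Rightarrow> real" where
  "theta V X k l = (SUP Y\<in>theta_feasible V X k l. objective V X k l Y)"

definition theta_hat :: "'v::linorder set \<Rightarrow> 'v set set \<Rightarrow> nat \<Rightarrow> nat \<Rightarrow> real" where
  "theta_hat V X k l = (SUP Y\<in>theta_hat_feasible V X k l. objective V X k l Y)"

end

theory Submission
  imports Defs
begin

text \<open>
  On \<open>\<Y>\<^sub>j\<close> the objective is a linear combination of the sum of \<open>y\<close> over \<open>Ind\<^sub>j\<close> and the sum of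
  \<open>y\<close> over \<open>Ind\<^sub>j\<^sub>+\<^sub>1\<close>, and double counting shows that \<open>\<tau>\<^sub>j\<close> preserves both trace and objective.
  Hence \<open>\<tau>\<^sub>\<ell>\<close> sends feasible points for \<open>\<ell> + 1\<close> to feasible points for \<open>\<ell>\<close> with the same value.
  At \<open>\<ell> = \<alpha>(X)\<close> there are no larger independent sets, so the objective is the constant \<open>\<ell>\<close>.
  Feasible points exist because, for an independent set \<open>A\<close> of maximum size, the down-Laplacian
  of the full simplex on \<open>A\<close> is a Gram matrix and \<open>\<tau>\<^sub>j\<close> maps it to a nonnegative multiple of the
  down-Laplacian one dimension lower.
\<close>

section \<open>Vector coordinates, independent sets and incidence counts\<close>

text \<open>Surjectivity of \<open>vec_of_mat\<close> onto \<open>Yvecs\<close> turns its left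
  inverse \<open>mat_of_vec\<close> into a right inverse.\<close>

lemma vec_of_mat_of_vec:
  assumes "y \<in> Yvecs V X k j"
  shows "vec_of_mat V X k j (mat_of_vec V X k j y) = y"
proof -
  obtain Y where "Y \<in> Ymats V X k j" "y = vec_of_mat V X k j Y"
    using assms bij_betw_vec_of_mat(1)[of V X k j] by (auto simp: bij_betw_def)
  then show ?thesis using bij_betw_vec_of_mat(2) by metis
qed

lemma independent_set_mono: "independent_set V X k A \<Longrightarrow> B \<subseteq> A \<Longrightarrow> independent_set V X k B"
  unfolding independent_set_def by blast

lemma IndD:
  assumes "F \<in> Ind V X k i"
  shows "finite F" "card F = i + 1" "independent_set V X k F" "F \<subseteq> V"
  using assms by (auto simp: Ind_def independent_set_def intro: card_ge_0_finite)

lemma finite_Ind: "finite V \<Longrightarrow> finite (Ind V X k i)"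
  by (rule finite_subset[of _ "Pow V"]) (auto dest: IndD)

lemma Ind_disjoint: "F \<in> Ind V X k i \<Longrightarrow> F \<in> Ind V X k j \<Longrightarrow> i = j"
  by (simp add: Ind_def)

text \<open>Subsets of independent sets are independent, so this counts all subsets of
  \<open>F\<close> missing exactly one element.\<close>

lemma card_Ind_below:
  assumes F: "F \<in> Ind V X k (i + 1)"
  shows "card {K \<in> Ind V X k i. K \<subset> F} = i + 2"
proof -
  have "{K \<in> Ind V X k i. K \<subset> F} = {K. K \<subseteq> F \<and> card K = i + 1}"
    using IndD[OF F] by (auto simp: Ind_def intro: independent_set_mono)
  then show ?thesis using IndD[OF F] by (simp add: n_subsets)
qed

lemma sum_Ind_above:
  fixes y :: "'v set \<Rightarrow> real"
  assumes "finite V"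
  shows "(\<Sum>K\<in>Ind V X k i. \<Sum>F | F \<in> Ind V X k (i + 1) \<and> K \<subset> F. y F)
       = real (i + 2) * (\<Sum>F\<in>Ind V X k (i + 1). y F)"
proof -
  have "(\<Sum>K\<in>Ind V X k i. \<Sum>F | F \<in> Ind V X k (i + 1) \<and> K \<subset> F. y F)
      = (\<Sum>F\<in>Ind V X k (i + 1). \<Sum>K | K \<in> Ind V X k i \<and> K \<subset> F. y F)"
    by (rule sum.swap_restrict) (simp_all add: finite_Ind assms)
  also have "\<dots> = (\<Sum>F\<in>Ind V X k (i + 1). real (i + 2) * y F)"
    by (intro sum.cong refl) (simp only: sum_constant card_Ind_below)
  finally show ?thesis by (simp add: sum_distrib_left)
qed

text \<open>Such an \<open>F'\<close> is \<open>H\<close> minus one vertex, and the missing vertex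
  must lie in \<open>F\<close> for the union to be all of \<open>H\<close>; this leaves
  \<open>j + 1\<close> choices.\<close>

lemma card_Ind_pairs:
  assumes H: "H \<in> Ind V X k (j + 1)" and F: "F \<in> Ind V X k j" and "F \<subset> H"
  shows "card {F' \<in> Ind V X k j. F' \<noteq> F \<and> F \<union> F' = H} = j + 1"
proof -
  note fin = IndD[OF H] IndD[OF F]
  have "bij_betw (\<lambda>x. H - {x}) F {F' \<in> Ind V X k j. F' \<noteq> F \<and> F \<union> F' = H}"
  proof (rule bij_betw_imageI)
    show "inj_on (\<lambda>x. H - {x}) F" using \<open>F \<subset> H\<close> by (auto simp: inj_on_def)
    show "(\<lambda>x. H - {x}) ` F = {F' \<in> Ind V X k j. F' \<noteq> F \<and> F \<union> F' = H}"
    proof (intro equalityI subsetI)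
      fix G assume "G \<in> (\<lambda>x. H - {x}) ` F"
      then obtain x where x: "x \<in> F" "G = H - {x}" by blast
      have xH: "x \<in> H" using x \<open>F \<subset> H\<close> by blast
      have "card G = j + 1" using fin(1,2) x xH by simp
      moreover have "independent_set V X k G" using fin(3) x independent_set_mono by blast
      ultimately have "G \<in> Ind V X k j" by (simp add: Ind_def)
      moreover have "G \<noteq> F" "F \<union> G = H" using x \<open>F \<subset> H\<close> by blast+
      ultimately show "G \<in> {F' \<in> Ind V X k j. F' \<noteq> F \<and> F \<union> F' = H}"
        by simp
    next
      fix G assume G: "G \<in> {F' \<in> Ind V X k j. F' \<noteq> F \<and> F \<union> F' = H}"
      then have G': "card G = j + 1" "G \<subseteq> H" "finite G" using IndD[of G V X k j] by auto
      then have "card (H - G) = 1" using fin by (simp add: card_Diff_subset)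
      then obtain x where x: "H - G = {x}" by (auto simp: card_1_singleton_iff)
      have "x \<in> F" using x G by blast
      moreover have "G = H - {x}" using x G' by blast
      ultimately show "G \<in> (\<lambda>x. H - {x}) ` F" by blast
    qed
  qed
  from bij_betw_same_card[OF this] show ?thesis using fin by simp
qed

lemma card_Ind_Un:
  assumes "F \<in> Ind V X k j" "F' \<in> Ind V X k j"
  shows "card (F \<union> F') + card (F \<inter> F') = 2 * j + 2"
  using card_Un_Int[of F F'] IndD[OF assms(1)] IndD[OF assms(2)] by simp

lemma eps_Ind_square:
  assumes "F \<in> Ind V X k j" "F' \<in> Ind V X k j" "F \<union> F' \<in> Ind V X k (j + 1)"
  shows "eps F F' * eps F F' = 1"
proof (rule eps_square[of _ _ j])
  show "F \<noteq> F'" using Ind_disjoint[of F V X k j "j + 1"] assms by auto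
qed (use assms in \<open>auto simp: Ind_def\<close>)

section \<open>Trace and objective as sums of coordinates\<close>

lemma mat_trace_mat_of_vec:
  "mat_trace (Ind V X k j) (mat_of_vec V X k j y) = (\<Sum>F\<in>Ind V X k j. y F)"
  by (simp add: mat_trace_def mat_of_vec_def)

text \<open>Off the diagonal the sign of \<open>Ldown\<close> cancels the sign in the matrix entry,
  leaving \<open>y (F \<union> F')\<close>. Each \<open>H\<close> is the union of
  \<open>(j + 2) * (j + 1)\<close> ordered pairs of distinct members of
  \<open>Ind V X k j\<close>.\<close>

lemma objective_mat_of_vec:
  assumes "finite V"
  shows "objective V X k (j + 1) (mat_of_vec V X k j y)
    = real (j + 1) * (\<Sum>F\<in>Ind V X k j. y F)
    + real (j + 1) * real (j + 2) * (\<Sum>H\<in>Ind V X k (j + 1). y H)"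
proof -
  let ?I = "Ind V X k j" and ?J = "Ind V X k (j + 1)" and ?Y = "mat_of_vec V X k j y"
  have fin: "finite ?I" "finite ?J" using assms by (simp_all add: finite_Ind)
  have row: "(\<Sum>F'\<in>?I. Ldown (j + 1) F F' * ?Y F' F)
      = real (j + 1) * y F + real (j + 1) * (\<Sum>H | H \<in> ?J \<and> F \<subset> H. y H)"
    if F: "F \<in> ?I" for F
  proof -
    have "(\<Sum>F'\<in>?I. Ldown (j + 1) F F' * ?Y F' F)
        = Ldown (j + 1) F F * ?Y F F + (\<Sum>F'\<in>?I - {F}. Ldown (j + 1) F F' * ?Y F' F)"
      using fin F by (simp add: sum.remove)
    \<comment> \<open>Each entry is rewritten as a sum over \<open>H\<close> with at most one term,
      so that exchanging the sums groups the \<open>F'\<close> by their union with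
      \<open>F\<close>.\<close>
    also have "(\<Sum>F'\<in>?I - {F}. Ldown (j + 1) F F' * ?Y F' F)
        = (\<Sum>F'\<in>?I - {F}. \<Sum>H | H \<in> {H \<in> ?J. F \<subset> H} \<and> F \<union> F' = H. y H)"
    proof (intro sum.cong refl)
      fix F' assume F': "F' \<in> ?I - {F}"
      \<comment> \<open>The inclusion is strict because \<open>F\<close> and \<open>F'\<close> are
        distinct sets of equal size.\<close>
      have sub: "F \<subset> F \<union> F'"
        using F' F card_subset_eq[of F F'] IndD(1,2)[of F V X k j] IndD(2)[of F' V X k j] by auto
      show "Ldown (j + 1) F F' * ?Y F' F = (\<Sum>H | H \<in> {H \<in> ?J. F \<subset> H} \<and> F \<union> F' = H. y H)"
      proof (cases "F \<union> F' \<in> ?J")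
        case True
        have "{H. H \<in> {H \<in> ?J. F \<subset> H} \<and> F \<union> F' = H} = {F \<union> F'}" using True sub by auto
        moreover have "Ldown (j + 1) F F' * ?Y F' F = eps F F' * eps F F' * y (F \<union> F')"
          using True F F' eps_sym[of F' F] by (auto simp: Ldown_def mat_of_vec_def Un_commute[of F' F])
        ultimately show ?thesis using eps_Ind_square[of F V X k j F'] F F' True by simp
      next
        case False
        then have "{H. H \<in> {H \<in> ?J. F \<subset> H} \<and> F \<union> F' = H} = {}" by auto
        then have "(\<Sum>H | H \<in> {H \<in> ?J. F \<subset> H} \<and> F \<union> F' = H. y H) = 0" by (simp only: sum.empty)
          then show ?thesis using False F' by (simp add: mat_of_vec_def Un_commute[of F' F])
      qed
    qed
    also have "\<dots> = (\<Sum>H\<in>{H \<in> ?J. F \<subset> H}. \<Sum>F' | F' \<in> ?I - {F} \<and> F \<union> F' = H. y H)"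
      by (rule sum.swap_restrict) (use fin in auto)
    also have "\<dots> = (\<Sum>H\<in>{H \<in> ?J. F \<subset> H}. real (j + 1) * y H)"
    proof (intro sum.cong refl)
      fix H assume H: "H \<in> {H \<in> ?J. F \<subset> H}"
      have "{F'. F' \<in> ?I - {F} \<and> F \<union> F' = H} = {F' \<in> ?I. F' \<noteq> F \<and> F \<union> F' = H}" by auto
      then show "(\<Sum>F' | F' \<in> ?I - {F} \<and> F \<union> F' = H. y H) = real (j + 1) * y H"
        using card_Ind_pairs[of H V X k j F] H F by simp
    qed
    finally show ?thesis
      using F by (simp add: Ldown_def mat_of_vec_def sum_distrib_left)
  qed
  have "objective V X k (j + 1) ?Y = (\<Sum>F\<in>?I. \<Sum>F'\<in>?I. Ldown (j + 1) F F' * ?Y F' F)"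
    by (simp add: objective_def mat_trace_def mat_mult_def)
  also have "\<dots> = (\<Sum>F\<in>?I. real (j + 1) * y F + real (j + 1) * (\<Sum>H | H \<in> ?J \<and> F \<subset> H. y H))"
    by (intro sum.cong refl row)
  also have "\<dots> = real (j + 1) * (\<Sum>F\<in>?I. y F)
      + real (j + 1) * (\<Sum>F\<in>?I. \<Sum>H | H \<in> ?J \<and> F \<subset> H. y H)"
    by (simp only: sum.distrib sum_distrib_left)
  also have "(\<Sum>F\<in>?I. \<Sum>H | H \<in> ?J \<and> F \<subset> H. y H) = real (j + 2) * (\<Sum>H\<in>?J. y H)"
    by (rule sum_Ind_above) fact
  finally show ?thesis by (simp add: algebra_simps)
qed

section \<open>Invariance of trace and objective under \<open>tau\<close>\<close>

lemma tau_in_Ymats: "tau V X k j Y \<in> Ymats V X k (j - 1)"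
  unfolding tau_def by (rule mat_of_vec_in_Ymats)

lemma sum_tau_vec_lower:
  assumes "finite V"
  shows "(\<Sum>K\<in>Ind V X k i. tau_vec V X k (i + 1) y K) = (\<Sum>F\<in>Ind V X k (i + 1). y F)"
proof -
  have "(\<Sum>K\<in>Ind V X k i. tau_vec V X k (i + 1) y K)
      = 1 / real (i + 2) * (\<Sum>K\<in>Ind V X k i. \<Sum>F | F \<in> Ind V X k (i + 1) \<and> K \<subset> F. y F)"
    by (simp add: tau_vec_def sum_distrib_left)
  then show ?thesis by (simp only: sum_Ind_above[OF assms]) (simp add: field_simps)
qed

text \<open>The factor \<open>i + 3\<close> is the number of members of
  \<open>Ind V X k (i + 1)\<close> below each \<open>H\<close>.\<close>

lemma sum_tau_vec_upper:
  assumes "finite V"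
  shows "(\<Sum>F\<in>Ind V X k (i + 1). tau_vec V X k (i + 1) y F)
    = 1 / real ((i + 2) * (i + 1)) * (\<Sum>F\<in>Ind V X k (i + 1). y F)
    + real (i + 3) / real (i + 1) * (\<Sum>H\<in>Ind V X k (i + 2). y H)"
proof -
  have "(\<Sum>F\<in>Ind V X k (i + 1). tau_vec V X k (i + 1) y F)
      = (\<Sum>F\<in>Ind V X k (i + 1). 1 / real ((i + 2) * (i + 1)) * y F
         + 1 / real (i + 1) * (\<Sum>H | H \<in> Ind V X k (i + 1 + 1) \<and> F \<subset> H. y H))"
  proof (intro sum.cong refl)
    fix F assume "F \<in> Ind V X k (i + 1)"
    moreover from this have "F \<notin> Ind V X k i" using Ind_disjoint by fastforce
    ultimately show "tau_vec V X k (i + 1) y F = 1 / real ((i + 2) * (i + 1)) * y F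
         + 1 / real (i + 1) * (\<Sum>H | H \<in> Ind V X k (i + 1 + 1) \<and> F \<subset> H. y H)"
      by (simp add: tau_vec_def)
  qed
  also have "\<dots> = 1 / real ((i + 2) * (i + 1)) * (\<Sum>F\<in>Ind V X k (i + 1). y F)
      + 1 / real (i + 1)
        * (\<Sum>F\<in>Ind V X k (i + 1). \<Sum>H | H \<in> Ind V X k (i + 1 + 1) \<and> F \<subset> H. y H)"
    by (simp only: sum.distrib sum_distrib_left)
  finally show ?thesis
    by (simp only: sum_Ind_above[OF assms]) (simp add: algebra_simps add_divide_distrib)
qed

lemma mat_trace_tau:
  assumes "finite V" "Y \<in> Ymats V X k (i + 1)"
  shows "mat_trace (Ind V X k i) (tau V X k (i + 1) Y) = mat_trace (Ind V X k (i + 1)) Y"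
proof -
  let ?y = "vec_of_mat V X k (i + 1) Y"
  have "Y = mat_of_vec V X k (i + 1) ?y" using bij_betw_vec_of_mat(2) assms by metis
  then have "mat_trace (Ind V X k (i + 1)) Y = (\<Sum>F\<in>Ind V X k (i + 1). ?y F)"
    by (metis mat_trace_mat_of_vec)
  moreover have "mat_trace (Ind V X k i) (tau V X k (i + 1) Y)
      = (\<Sum>K\<in>Ind V X k i. tau_vec V X k (i + 1) ?y K)"
    unfolding tau_def using mat_trace_mat_of_vec[of V X k i] by simp
  ultimately show ?thesis by (simp only: sum_tau_vec_lower[OF assms(1)])
qed

text \<open>The normalisation of \<open>tau\<close> is what makes this work: weighted by
  \<open>(i + 1) * (i + 2)\<close>, the first summand of the upper coordinates contributes exactly
  one further \<open>?S\<close>, raising its coefficient from \<open>i + 1\<close> to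
  \<open>i + 2\<close>, and the second gives the required multiple of \<open>?T\<close>.\<close>

lemma objective_tau:
  assumes "finite V" "Y \<in> Ymats V X k (i + 1)"
  shows "objective V X k (i + 1) (tau V X k (i + 1) Y) = objective V X k (i + 2) Y"
proof -
  let ?y = "vec_of_mat V X k (i + 1) Y"
  have Y: "Y = mat_of_vec V X k (i + 1) ?y" using bij_betw_vec_of_mat(2) assms by metis
  let ?S = "\<Sum>F\<in>Ind V X k (i + 1). ?y F" and ?T = "\<Sum>H\<in>Ind V X k (i + 2). ?y H"
  have "objective V X k (i + 2) Y = objective V X k (i + 1 + 1) (mat_of_vec V X k (i + 1) ?y)"
    using Y by simp
  also have "\<dots> = real (i + 2) * ?S + real (i + 2) * real (i + 3) * ?T"
    by (simp only: objective_mat_of_vec[OF assms(1)]) (simp add: algebra_simps)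
  finally have 1: "objective V X k (i + 2) Y = real (i + 2) * ?S + real (i + 2) * real (i + 3) * ?T" .
  have "objective V X k (i + 1) (tau V X k (i + 1) Y)
      = real (i + 1) * ?S + real (i + 1) * real (i + 2)
        * (1 / real ((i + 2) * (i + 1)) * ?S + real (i + 3) / real (i + 1) * ?T)"
    unfolding tau_def add_diff_cancel_right'
    by (simp only: objective_mat_of_vec[OF assms(1)] sum_tau_vec_lower[OF assms(1)]
        sum_tau_vec_upper[OF assms(1)])
  also have "\<dots> = real (i + 1) * ?S + ?S + real (i + 2) * real (i + 3) * ?T"
  proof -
    have "a * S + a * b * (1 / (b * a) * S + d / a * T) = a * S + S + b * d * T"
      if "a > 0" "b > 0" for a b d S T :: real
      using that by (simp add: field_simps)
    from this[of "real (i + 1)" "real (i + 2)"] show ?thesis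
      unfolding of_nat_mult by simp
  qed
  finally show ?thesis using 1 by (simp add: algebra_simps)
qed

section \<open>Boundedness of the objective\<close>

text \<open>Testing the quadratic form on the sum and the difference of two unit vectors bounds
  twice the absolute entry by the sum of two diagonal entries. Diagonal entries are nonnegative,
  hence at most the trace.\<close>

lemma pos_semidef_entry_le:
  assumes "finite I" "pos_semidef I A" "i \<in> I" "j \<in> I"
  shows "\<bar>A i j\<bar> \<le> mat_trace I A"
proof -
  have quad: "0 \<le> A i i + 2 * s * A i j + s * s * A j j" if "i \<in> I" "j \<in> I" for s i j
  proof -
    \<comment> \<open>Adding two indicators instead of nesting conditionals also covers
      \<open>i = j\<close>, which yields the diagonal bound.\<close>
    let ?x = "\<lambda>m. (if m = i then 1 else 0) + (if m = j then s else 0)"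
    have row: "(\<Sum>n\<in>I. A m n * ?x n) = A m i + s * A m j" for m
      using assms(1) that by (simp add: distrib_left sum.distrib if_distrib[of "\<lambda>z. A _ _ * z"] cong: if_cong)
    have "0 \<le> (\<Sum>m\<in>I. \<Sum>n\<in>I. ?x m * A m n * ?x n)"
      using assms(2) unfolding pos_semidef_def by (rule conjunct2[THEN spec])
    also have "\<dots> = (\<Sum>m\<in>I. ?x m * (A m i + s * A m j))"
      by (simp only: mult.assoc row flip: sum_distrib_left)
    also have "\<dots> = (A i i + s * A i j) + s * (A j i + s * A j j)"
      using assms(1) that
      by (simp add: distrib_right sum.distrib if_distrib[of "\<lambda>z. z * _"] cong: if_cong)
    also have "A j i = A i j" using assms(2) that by (simp add: pos_semidef_def)
    finally show ?thesis by (simp add: algebra_simps)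
  qed
  have diag: "0 \<le> A m m" if "m \<in> I" for m using quad[of m m 0] that by simp
  have tr: "A m m \<le> mat_trace I A" if "m \<in> I" for m
    unfolding mat_trace_def by (rule member_le_sum) (use that assms diag in auto)
  show ?thesis
    using quad[of i j 1] quad[of i j "-1"] tr[of i] tr[of j] assms by simp
qed

text \<open>A real \<open>SUP\<close> is only meaningful for sets bounded above. Trace 1 bounds
  every entry of \<open>Y\<close> by 1 in absolute value, which gives a bound independent of
  \<open>Y\<close>.\<close>

lemma bdd_above_objective_theta:
  assumes "finite V"
  shows "bdd_above (objective V X k l ` theta_feasible V X k l)"
proof (rule bdd_aboveI2)
  fix Y assume Y: "Y \<in> theta_feasible V X k l"
  let ?I = "Ind V X k (l - 1)"
  have "objective V X k l Y = (\<Sum>F\<in>?I. \<Sum>F'\<in>?I. Ldown l F F' * Y F' F)"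
    by (simp add: objective_def mat_trace_def mat_mult_def)
  also have "\<dots> \<le> (\<Sum>F\<in>?I. \<Sum>F'\<in>?I. \<bar>Ldown l F F'\<bar>)"
  proof (intro sum_mono)
    fix F F' assume F: "F \<in> ?I" "F' \<in> ?I"
    have "\<bar>Y F' F\<bar> \<le> 1"
      using pos_semidef_entry_le[of ?I Y F' F] F Y finite_Ind[OF assms]
      by (simp add: theta_feasible_def)
    then have "\<bar>Ldown l F F'\<bar> * \<bar>Y F' F\<bar> \<le> \<bar>Ldown l F F'\<bar> * 1" by (intro mult_left_mono) auto
    then show "Ldown l F F' * Y F' F \<le> \<bar>Ldown l F F'\<bar>"
      by (metis abs_ge_self abs_mult mult.right_neutral order_trans)
  qed
  finally show "objective V X k l Y \<le> (\<Sum>F\<in>?I. \<Sum>F'\<in>?I. \<bar>Ldown l F F'\<bar>)" .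
qed

section \<open>Passing feasible points one level down\<close>

lemma theta_hat_feasible_subset: "theta_hat_feasible V X k l \<subseteq> theta_feasible V X k l"
  by (auto simp: theta_hat_feasible_def)

lemma bdd_above_objective_theta_hat:
  "finite V \<Longrightarrow> bdd_above (objective V X k l ` theta_hat_feasible V X k l)"
  by (rule bdd_above_mono[OF bdd_above_objective_theta[of V X k l]])
    (simp_all add: image_mono theta_hat_feasible_subset)

lemma tau_theta_hat_feasible:
  assumes V: "finite V" and l: "l \<ge> 1" and Y: "Y \<in> theta_hat_feasible V X k (l + 1)"
  shows "tau V X k l Y \<in> theta_hat_feasible V X k l"
    and "objective V X k l (tau V X k l Y) = objective V X k (l + 1) Y"
proof -
  obtain i where i: "l = i + 1" using l by (metis Suc_eq_plus1 Suc_le_D One_nat_def)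
  have YM: "Y \<in> Ymats V X k (i + 1)" and trace: "mat_trace (Ind V X k (i + 1)) Y = 1"
    using Y i by (auto simp: theta_hat_feasible_def theta_feasible_def)
  \<comment> \<open>Splitting \<open>l\<close> off the end of \<open>[m..<l + 1]\<close> makes
    \<open>tau V X k l\<close> the innermost map, so these are the extra constraints on
    \<open>Y\<close>. The case \<open>m = l\<close> is semidefiniteness of the image itself.\<close>
  have psd: "pos_semidef (Ind V X k (m - 1)) (foldr (tau V X k) [m..<l] (tau V X k l Y))"
    if "1 \<le> m" "m \<le> l" for m
    using Y that by (force simp: theta_hat_feasible_def)
  have "tau V X k l Y \<in> theta_feasible V X k l"
    unfolding theta_feasible_def
    using tau_in_Ymats[of V X k l Y] mat_trace_tau[OF V YM] trace psd[of l] l i by simp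
  then show "tau V X k l Y \<in> theta_hat_feasible V X k l"
    using psd l unfolding theta_hat_feasible_def by auto
  show "objective V X k l (tau V X k l Y) = objective V X k (l + 1) Y"
    using objective_tau[OF V YM] i by simp
qed

section \<open>Feasible points supported on an independent set\<close>

text \<open>For \<open>c = 1\<close>, \<open>mat_of_vec\<close> turns this vector into the down-Laplacian of the full simplex on \<open>A\<close>.\<close>

definition simplex_vec ::
  "'v::linorder set \<Rightarrow> 'v set set \<Rightarrow> nat \<Rightarrow> 'v set \<Rightarrow> nat \<Rightarrow> real \<Rightarrow> 'v set \<Rightarrow> real" where
  "simplex_vec V X k A j c = (\<lambda>G.
     if G \<in> Ind V X k j \<and> G \<subseteq> A then c * real (j + 1)
     else if G \<in> Ind V X k (j + 1) \<and> G \<subseteq> A then c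
     else 0)"

lemma simplex_vec_in_Yvecs: "simplex_vec V X k A j c \<in> Yvecs V X k j"
  by (simp add: simplex_vec_def Yvecs_def)

text \<open>This is the product of the transposed boundary matrix with itself. On the diagonal,
  \<open>j + 1\<close> squared signs add up; off the diagonal, the only possible common
  \<open>K\<close> is \<open>F \<inter> F'\<close>.\<close>

lemma Ldown_eq_sum:
  assumes "finite A" "F \<subseteq> A" "F' \<subseteq> A" "card F = j + 1" "card F' = j + 1"
  shows "Ldown (j + 1) F F' = (\<Sum>K | K \<subseteq> A \<and> card K = j.
    (if K \<subset> F then incidence F K else 0) * (if K \<subset> F' then incidence F' K else 0))"
    (is "_ = (\<Sum>K\<in>?S. ?b K)")
proof -
  have finS: "finite ?S" using assms(1) by simp
  have fin: "finite F" "finite F'" using assms by (auto intro: finite_subset)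
  let ?P = "{K. K \<subset> F \<and> K \<subset> F' \<and> card K = j}"
  have b: "(\<Sum>K\<in>?S. ?b K) = (\<Sum>K\<in>?P. incidence F K * incidence F' K)"
  proof -
    have "(\<Sum>K\<in>?S. ?b K) = (\<Sum>K\<in>?P. ?b K)"
      by (rule sum.mono_neutral_right) (use finS assms in auto)
    then show ?thesis by simp
  qed
  show ?thesis
  proof (cases "F = F'")
    case True
    have "?P = {K. K \<subseteq> F \<and> card K = j}" using True assms by auto
    moreover have "incidence F K * incidence F K = 1" for K
      unfolding incidence_def by (simp flip: power_mult_distrib)
    ultimately show ?thesis
      using b True fin assms by (simp add: Ldown_def n_subsets)
  next
    case False
    have sub: "F \<inter> F' \<subset> F" "F \<inter> F' \<subset> F'"
      using False fin assms card_subset_eq[of F F'] card_subset_eq[of F' F] by auto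
    then have lt: "card (F \<inter> F') \<le> j" using psubset_card_mono[OF fin(1) sub(1)] assms by simp
    show ?thesis
    proof (cases "card (F \<inter> F') = j")
      case True
      have "?P = {F \<inter> F'}"
      proof
        show "?P \<subseteq> {F \<inter> F'}"
          using card_subset_eq[of "F \<inter> F'"] fin True by (auto simp: psubset_imp_subset)
      qed (use sub True in auto)
      then show ?thesis using b False True assms by (simp add: Ldown_def eps_def)
    next
      case f: False
      \<comment> \<open>A common subset \<open>K\<close> has at most
        \<open>card (F \<inter> F')\<close> elements, which is now less than
        \<open>j\<close>.\<close>
      have "K \<notin> ?P" for K
        using card_mono[of "F \<inter> F'" K] fin lt f by auto
      then have "?P = {}" by blast
      then have "(\<Sum>K\<in>?S. ?b K) = 0" unfolding b by (simp only: sum.empty)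
      then show ?thesis using False f assms by (simp add: Ldown_def eps_def)
    qed
  qed
qed

text \<open>The point to check is where \<open>mat_of_vec\<close> inserts 0 for \<open>F\<close> and
  \<open>F'\<close> inside \<open>A\<close>: their union is independent, so it can only fail to be
  in \<open>Ind V X k (j + 1)\<close> by its size, and then \<open>eps\<close> vanishes as
  well.\<close>

lemma simplex_mat_eq:
  assumes "independent_set V X k A"
    and F: "F \<in> Ind V X k j" "F' \<in> Ind V X k j"
  shows "mat_of_vec V X k j (simplex_vec V X k A j c) F F'
    = (if F \<subseteq> A \<and> F' \<subseteq> A then c * Ldown (j + 1) F F' else 0)"
proof (cases "F = F'")
  case True
  then show ?thesis using F by (auto simp: mat_of_vec_def simplex_vec_def Ldown_def)
next
  case False
  have nI: "F \<union> F' \<in> Ind V X k (j + 1) \<Longrightarrow> F \<union> F' \<notin> Ind V X k j"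
    using Ind_disjoint by fastforce
  show ?thesis
  proof (cases "F \<union> F' \<in> Ind V X k (j + 1)")
    case True
    then show ?thesis using F False nI by (auto simp: mat_of_vec_def simplex_vec_def Ldown_def)
  next
    case f: False
    have "eps F F' = 0" if "F \<subseteq> A" "F' \<subseteq> A"
    proof -
      have "independent_set V X k (F \<union> F')" using that assms independent_set_mono by blast
      then have "card (F \<union> F') \<noteq> j + 2" using f by (simp add: Ind_def)
      then show ?thesis using card_Ind_Un[OF F] IndD[OF F(1)] by (simp add: eps_def)
    qed
    then show ?thesis using F False f by (simp add: mat_of_vec_def Ldown_def)
  qed
qed

text \<open>By the Gram representation the quadratic form is \<open>c\<close> times a sum of squares
  indexed by the subsets \<open>K\<close> of \<open>A\<close> of size \<open>j\<close>.\<close>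

lemma pos_semidef_simplex_mat:
  assumes V: "finite V" and A: "independent_set V X k A" and c: "c \<ge> 0"
  shows "pos_semidef (Ind V X k j) (mat_of_vec V X k j (simplex_vec V X k A j c))"
  unfolding pos_semidef_def
proof (intro conjI ballI allI)
  let ?I = "Ind V X k j" and ?Y = "mat_of_vec V X k j (simplex_vec V X k A j c)"
  let ?S = "{K. K \<subseteq> A \<and> card K = j}"
  show "?Y F F' = ?Y F' F" if "F \<in> ?I" "F' \<in> ?I" for F F'
    using mat_of_vec_in_Ymats[of V X k j "simplex_vec V X k A j c"] that by (simp add: Ymats_def)
  fix x :: "'a set \<Rightarrow> real"
  have finA: "finite A" using A V by (auto simp: independent_set_def intro: finite_subset)
  \<comment> \<open>The coordinate at \<open>K\<close> of the boundary of \<open>F\<close>, weighted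
    by \<open>x F\<close> and restricted to \<open>A\<close>.\<close>
  define b where "b K F = (if F \<subseteq> A \<and> K \<subset> F then incidence F K else 0) * x F" for K F
  have entry: "x F * ?Y F F' * x F' = (\<Sum>K\<in>?S. c * (b K F * b K F'))"
    if F: "F \<in> ?I" "F' \<in> ?I" for F F'
  proof (cases "F \<subseteq> A \<and> F' \<subseteq> A")
    case True
    have L: "Ldown (j + 1) F F' = (\<Sum>K\<in>?S.
        (if K \<subset> F then incidence F K else 0) * (if K \<subset> F' then incidence F' K else 0))"
      by (rule Ldown_eq_sum) (use True finA IndD(2)[OF F(1)] IndD(2)[OF F(2)] in simp_all)
    have "x F * ?Y F F' * x F' = (c * x F * x F') * Ldown (j + 1) F F'"
      unfolding simplex_mat_eq[OF A F] using True by simp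
    also have "\<dots> = (\<Sum>K\<in>?S. c * (b K F * b K F'))"
      unfolding L sum_distrib_left by (rule sum.cong) (use True in \<open>simp_all add: b_def\<close>)
    finally show ?thesis .
  next
    case False
    then have "(\<Sum>K\<in>?S. c * (b K F * b K F')) = 0" by (intro sum.neutral) (auto simp: b_def)
    then show ?thesis using False unfolding simplex_mat_eq[OF A F] by auto
  qed
  have "(\<Sum>F\<in>?I. \<Sum>F'\<in>?I. x F * ?Y F F' * x F')
      = (\<Sum>F\<in>?I. \<Sum>F'\<in>?I. \<Sum>K\<in>?S. c * (b K F * b K F'))"
    by (intro sum.cong refl entry)
  also have "\<dots> = (\<Sum>K\<in>?S. \<Sum>F\<in>?I. \<Sum>F'\<in>?I. c * (b K F * b K F'))"
  proof -
    have "(\<Sum>F\<in>?I. \<Sum>F'\<in>?I. \<Sum>K\<in>?S. c * (b K F * b K F'))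
        = (\<Sum>F\<in>?I. \<Sum>K\<in>?S. \<Sum>F'\<in>?I. c * (b K F * b K F'))"
      by (rule sum.cong[OF refl]) (rule sum.swap)
    also have "\<dots> = (\<Sum>K\<in>?S. \<Sum>F\<in>?I. \<Sum>F'\<in>?I. c * (b K F * b K F'))" by (rule sum.swap)
    finally show ?thesis .
  qed
  also have "\<dots> = (\<Sum>K\<in>?S. c * ((\<Sum>F\<in>?I. b K F) * (\<Sum>F'\<in>?I. b K F')))"
    unfolding sum_product by (simp only: sum_distrib_left)
  also have "\<dots> \<ge> 0" using c by (intro sum_nonneg) simp
  finally show "0 \<le> (\<Sum>F\<in>?I. \<Sum>F'\<in>?I. x F * ?Y F F' * x F')" .
qed

text \<open>Every such \<open>F\<close> arises from \<open>G\<close> by adding one vertex of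
  \<open>A - G\<close>, and any such vertex works because subsets of \<open>A\<close> are
  independent.\<close>

lemma card_Ind_above:
  assumes V: "finite V" and A: "independent_set V X k A" and G: "G \<in> Ind V X k i" "G \<subseteq> A"
  shows "real (card {F \<in> Ind V X k (i + 1). G \<subset> F \<and> F \<subseteq> A}) = real (card A) - real (i + 1)"
proof -
  have finA: "finite A" using A V by (auto simp: independent_set_def intro: finite_subset)
  note finG = IndD[OF G(1)]
  have "bij_betw (\<lambda>x. insert x G) (A - G) {F \<in> Ind V X k (i + 1). G \<subset> F \<and> F \<subseteq> A}"
  proof (rule bij_betw_imageI)
    show "inj_on (\<lambda>x. insert x G) (A - G)" by (auto simp: inj_on_def)
    show "(\<lambda>x. insert x G) ` (A - G) = {F \<in> Ind V X k (i + 1). G \<subset> F \<and> F \<subseteq> A}"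
    proof (intro equalityI subsetI)
      fix F assume "F \<in> (\<lambda>x. insert x G) ` (A - G)"
      then show "F \<in> {F \<in> Ind V X k (i + 1). G \<subset> F \<and> F \<subseteq> A}"
        using finG G independent_set_mono[OF A] by (auto simp: Ind_def)
    next
      fix F assume F: "F \<in> {F \<in> Ind V X k (i + 1). G \<subset> F \<and> F \<subseteq> A}"
      then have "card (F - G) = 1"
        using finG by (auto simp: card_Diff_subset Ind_def)
      then obtain x where x: "F - G = {x}" by (auto simp: card_1_singleton_iff)
      then have "F = insert x G" "x \<in> A - G" using F by auto
      then show "F \<in> (\<lambda>x. insert x G) ` (A - G)" by blast
    qed
  qed
  then have "card {F \<in> Ind V X k (i + 1). G \<subset> F \<and> F \<subseteq> A} = card (A - G)"
    by (simp add: bij_betw_same_card)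
  then show ?thesis
    using finG G finA card_mono[OF finA G(2)] by (simp add: card_Diff_subset of_nat_diff)
qed

lemma sum_Ind_above_indicator:
  assumes V: "finite V" and A: "independent_set V X k A" and G: "G \<in> Ind V X k i"
    and w: "\<And>F. F \<in> Ind V X k (i + 1) \<Longrightarrow> w F = (if F \<subseteq> A then d else 0)"
  shows "(\<Sum>F | F \<in> Ind V X k (i + 1) \<and> G \<subset> F. w F)
    = (if G \<subseteq> A then d * (real (card A) - real (i + 1)) else 0)"
proof -
  let ?T = "{F \<in> Ind V X k (i + 1). G \<subset> F \<and> F \<subseteq> A}"
  have "(\<Sum>F | F \<in> Ind V X k (i + 1) \<and> G \<subset> F. w F) = (\<Sum>F\<in>?T. d)"
    by (rule sum.mono_neutral_cong_right) (use w finite_Ind[OF V] in auto)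
  moreover have "card ?T = 0" if "\<not> G \<subseteq> A"
  proof -
    have "?T = {}" using that by auto
    then show ?thesis by (simp only: card.empty)
  qed
  ultimately show ?thesis
    using card_Ind_above[OF V A G] by (cases "G \<subseteq> A") simp_all
qed

text \<open>With \<open>N = card A\<close>, the lower coordinates become
  \<open>c * (N - (i + 1))\<close> and the upper ones
  \<open>c / (i + 1) * (1 + (N - (i + 2)))\<close>. Their ratio is \<open>i + 1\<close>, as the
  shape of \<open>simplex_vec\<close> at level \<open>i\<close> demands.\<close>

lemma tau_simplex_mat:
  assumes V: "finite V" and A: "independent_set V X k A"
  shows "tau V X k (i + 1) (mat_of_vec V X k (i + 1) (simplex_vec V X k A (i + 1) c))
    = mat_of_vec V X k i (simplex_vec V X k A i (c * (real (card A) - real (i + 1)) / real (i + 1)))"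
proof -
  let ?w = "simplex_vec V X k A (i + 1) c"
  let ?c = "c * (real (card A) - real (i + 1)) / real (i + 1)"
  have nI: "G \<notin> Ind V X k m" if "G \<in> Ind V X k n" "n \<noteq> m" for G m n
    using Ind_disjoint[of G V X k n m] that by auto
  have w1: "?w F = (if F \<subseteq> A then c * real (i + 2) else 0)" if "F \<in> Ind V X k (i + 1)" for F
    using that nI[of F "i + 1" "i + 1 + 1"] by (simp add: simplex_vec_def)
  have w2: "?w F = (if F \<subseteq> A then c else 0)" if "F \<in> Ind V X k (i + 1 + 1)" for F
    using that nI[of F "i + 1 + 1" "i + 1"] by (simp add: simplex_vec_def)
  have "tau_vec V X k (i + 1) ?w = simplex_vec V X k A i ?c"
  proof
    fix G
    consider "G \<in> Ind V X k i" | "G \<in> Ind V X k (i + 1)" "G \<notin> Ind V X k i"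
      | "G \<notin> Ind V X k i" "G \<notin> Ind V X k (i + 1)" by blast
    then show "tau_vec V X k (i + 1) ?w G = simplex_vec V X k A i ?c G"
    proof cases
      case 1
      then have "tau_vec V X k (i + 1) ?w G
          = 1 / real (i + 2) * (\<Sum>F | F \<in> Ind V X k (i + 1) \<and> G \<subset> F. ?w F)"
        by (simp add: tau_vec_def)
      also have "\<dots> = (if G \<subseteq> A then c * (real (card A) - real (i + 1)) else 0)"
        by (subst sum_Ind_above_indicator[OF V A 1 w1]) auto
      finally show ?thesis using 1 nI[OF 1, of "i + 1"] by (simp add: simplex_vec_def)
    next
      case 2
      then have "tau_vec V X k (i + 1) ?w G = 1 / real ((i + 2) * (i + 1)) * ?w G
          + 1 / real (i + 1) * (\<Sum>H | H \<in> Ind V X k (i + 1 + 1) \<and> G \<subset> H. ?w H)"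
        by (simp add: tau_vec_def)
      also have "\<dots> = (if G \<subseteq> A then 1 / real ((i + 2) * (i + 1)) * (c * real (i + 2))
          + 1 / real (i + 1) * (c * (real (card A) - real (i + 1 + 1))) else 0)"
        by (simp only: sum_Ind_above_indicator[OF V A 2(1) w2] w1[OF 2(1)]) auto
      also have "1 / real ((i + 2) * (i + 1)) * (c * real (i + 2))
          + 1 / real (i + 1) * (c * (real (card A) - real (i + 1 + 1))) = ?c"
      proof -
        have "1 / (b * a) * (c * b) + 1 / a * (c * (N - (a + 1))) = c * (N - a) / a"
          if "a > 0" "b > 0" for a b N :: real
          using that by (simp add: field_simps)
        from this[of "real (i + 1)" "real (i + 2)" "real (card A)"]
        show ?thesis by (simp only: of_nat_mult of_nat_add) simp
      qed
      finally show ?thesis using 2 by (simp add: simplex_vec_def)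
    next
      case 3
      then show ?thesis by (simp add: tau_vec_def simplex_vec_def)
    qed
  qed
  then show ?thesis
    by (simp add: tau_def vec_of_mat_of_vec[OF simplex_vec_in_Yvecs])
qed

text \<open>Applying \<open>tau\<close> at index \<open>n\<close> multiplies the coefficient by
  \<open>(card A - n) / n\<close>, which is nonnegative because \<open>n\<close> stays below
  \<open>card A\<close>.\<close>

lemma foldr_tau_simplex_mat:
  assumes V: "finite V" and A: "independent_set V X k A" and "c \<ge> 0" "l \<le> card A" "i \<ge> 1" "i \<le> l"
  shows "\<exists>d\<ge>0. foldr (tau V X k) [i..<l] (mat_of_vec V X k (l - 1) (simplex_vec V X k A (l - 1) c))
    = mat_of_vec V X k (i - 1) (simplex_vec V X k A (i - 1) d)"
  using assms(6,3,4)
proof (induction l arbitrary: c rule: dec_induct)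
  case base
  then show ?case by auto
next
  case (step n)
  obtain m where n: "n = m + 1" using step.hyps \<open>i \<ge> 1\<close> by (metis Suc_eq_plus1 Suc_le_D One_nat_def le_trans)
  let ?c = "c * (real (card A) - real (m + 1)) / real (m + 1)"
  have "?c \<ge> 0" using step.prems n by simp
  then show ?case
    using step.IH[of ?c] step.prems step.hyps tau_simplex_mat[OF V A, of m c] n by simp
qed

lemma theta_hat_feasible_nonempty:
  assumes V: "finite V" and A: "independent_set V X k A" and l: "l \<ge> 1" "l \<le> card A"
  shows "theta_hat_feasible V X k l \<noteq> {}"
proof -
  have finA: "finite A" using A V by (auto simp: independent_set_def intro: finite_subset)
  let ?T = "{F \<in> Ind V X k (l - 1). F \<subseteq> A}"
  obtain B where "B \<subseteq> A" "card B = l" using l by (meson obtain_subset_with_card_n)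
  then have "B \<in> ?T" using l A independent_set_mono by (auto simp: Ind_def)
  moreover have "finite ?T" using finite_Ind[OF V] by simp
  ultimately have N: "card ?T > 0" by (auto simp: card_gt_0_iff)
  \<comment> \<open>Normalises the trace: the \<open>card ?T\<close> nonzero diagonal entries all
    equal \<open>c * l\<close>.\<close>
  define c where "c = 1 / (real l * real (card ?T))"
  have c: "c \<ge> 0" by (simp add: c_def)
  let ?Y = "mat_of_vec V X k (l - 1) (simplex_vec V X k A (l - 1) c)"
  have "mat_trace (Ind V X k (l - 1)) ?Y = (\<Sum>F\<in>?T. c * real l)"
    unfolding mat_trace_mat_of_vec
    by (rule sum.mono_neutral_cong_right)
      (use finite_Ind[OF V] l Ind_disjoint[of _ V X k "l - 1" "l - 1 + 1"] in \<open>auto simp: simplex_vec_def\<close>)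
  also have "\<dots> = 1" using N l by (simp add: c_def)
  finally have "?Y \<in> theta_feasible V X k l"
    using mat_of_vec_in_Ymats pos_semidef_simplex_mat[OF V A c] by (simp add: theta_feasible_def)
  moreover have "pos_semidef (Ind V X k (i - 1)) (foldr (tau V X k) [i..<l] ?Y)"
    if "i \<in> {1..l - 1}" for i
    proof -
    have i: "1 \<le> i" "i \<le> l" using that by auto
    obtain d where "d \<ge> 0" "foldr (tau V X k) [i..<l] ?Y
        = mat_of_vec V X k (i - 1) (simplex_vec V X k A (i - 1) d)"
      using foldr_tau_simplex_mat[OF V A c l(2) i] by blast
    then show ?thesis using pos_semidef_simplex_mat[OF V A] by metis
  qed
  ultimately have "?Y \<in> theta_hat_feasible V X k l" by (simp add: theta_hat_feasible_def)
  then show ?thesis by blast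
qed

section \<open>The independence number and the chain of inequalities\<close>

lemma finite_independent_cards:
  assumes "finite V"
  shows "finite {card A |A. independent_set V X k A}"
  by (rule finite_subset[of _ "card ` Pow V"]) (use assms in \<open>auto simp: independent_set_def\<close>)

lemma card_le_indep_number:
  "finite V \<Longrightarrow> independent_set V X k A \<Longrightarrow> card A \<le> indep_number V X k"
  unfolding indep_number_def by (intro Max_ge finite_independent_cards) auto

lemma indep_number_attained:
  assumes "finite V" "independent_set V X k B"
  obtains A where "independent_set V X k A" "card A = indep_number V X k"
proof -
  have "indep_number V X k \<in> {card A |A. independent_set V X k A}"
    unfolding indep_number_def by (intro Max_in finite_independent_cards) (use assms in auto)
  then show ?thesis using that by auto
qed

text \<open>A finite nonempty family has an inclusion-maximal member, and purity gives it
  \<open>k + 1 > 0\<close> elements.\<close>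

lemma pure_complex_has_vertex:
  assumes "finite V" "simplicial_complex_on V X" "pure_of_dim k X"
  shows "V \<noteq> {}"
proof -
  have X: "finite X" "X \<noteq> {}"
    using assms finite_subset[of X "Pow V"] by (auto simp: simplicial_complex_on_def pure_of_dim_def)
  then obtain F where F: "F \<in> X" "\<forall>G\<in>X. F \<subseteq> G \<longrightarrow> F = G"
    using finite_has_maximal by metis
  then have "card F = k + 1" using assms(3) unfolding pure_of_dim_def by metis
  then have "F \<noteq> {}" by auto
  then show ?thesis using F assms(2) by (auto simp: simplicial_complex_on_def)
qed

theorem theorem8p2:
  fixes V :: "'v::linorder set" and X :: "'v set set" and k :: nat
  assumes "k \<ge> 1"
    and "finite V"
    and "simplicial_complex_on V X"
    and "pure_of_dim k X"
  shows "(\<forall>l. k \<le> l \<and> l \<le> indep_number V X k \<longrightarrow> theta_hat V X k l \<le> theta V X k l)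
    \<and> real (indep_number V X k) = theta_hat V X k (indep_number V X k)
    \<and> (\<forall>l. k \<le> l \<and> l < indep_number V X k \<longrightarrow> theta_hat V X k (l + 1) \<le> theta_hat V X k l)"
proof -
  let ?\<alpha> = "indep_number V X k"
  obtain v where "v \<in> V" using pure_complex_has_vertex[OF assms(2-4)] by blast
  \<comment> \<open>Since \<open>k \<ge> 1\<close>, these faces have at least two elements, so
    singletons are independent and the independence number is positive.\<close>
  have "\<not> F \<subseteq> {v}" if "F \<in> faces X k" for F
    using that \<open>k \<ge> 1\<close> card_mono[of "{v}" F] by (auto simp: faces_def)
  then have sing: "independent_set V X k {v}"
    using \<open>v \<in> V\<close> by (simp add: independent_set_def)
  then have \<alpha>: "?\<alpha> \<ge> 1" using card_le_indep_number[OF assms(2) sing] by simp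
  obtain A where A: "independent_set V X k A" "card A = ?\<alpha>"
    using indep_number_attained[OF assms(2) sing] .
  have ne: "theta_hat_feasible V X k l \<noteq> {}" if "1 \<le> l" "l \<le> ?\<alpha>" for l
    using theta_hat_feasible_nonempty[OF assms(2) A(1)] that A(2) by simp
  have 1: "theta_hat V X k l \<le> theta V X k l" if "k \<le> l" "l \<le> ?\<alpha>" for l
    unfolding theta_hat_def theta_def
    by (rule cSUP_subset_mono)
      (use ne[of l] that \<open>k \<ge> 1\<close> in
        \<open>simp_all add: bdd_above_objective_theta[OF assms(2)] theta_hat_feasible_subset\<close>)
  have "objective V X k ?\<alpha> Y = real ?\<alpha>" if Y: "Y \<in> theta_hat_feasible V X k ?\<alpha>" for Y
  proof -
    let ?j = "?\<alpha> - 1"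
    have YM: "Y \<in> Ymats V X k ?j" "mat_trace (Ind V X k ?j) Y = 1"
      using Y by (auto simp: theta_hat_feasible_def theta_feasible_def)
    define y where "y = vec_of_mat V X k ?j Y"
    have Yy: "Y = mat_of_vec V X k ?j y" using bij_betw_vec_of_mat(2) YM(1) y_def by metis
    \<comment> \<open>Its members would be independent sets with one element more than the maximum.
      Without them only \<open>?j + 1\<close> times the trace remains of the objective.\<close>
    have "Ind V X k (?j + 1) = {}"
    proof -
      have "F \<notin> Ind V X k (?j + 1)" for F
        using card_le_indep_number[OF assms(2) IndD(3)[of F V X k "?j + 1"]] IndD(2)[of F V X k "?j + 1"] \<alpha>
        by linarith
      then show ?thesis by blast
    qed
    then have "objective V X k (?j + 1) Y = real (?j + 1) * mat_trace (Ind V X k ?j) Y"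
      unfolding Yy objective_mat_of_vec[OF assms(2)] mat_trace_mat_of_vec by simp
    then show ?thesis using YM \<alpha> by simp
  qed
  then have 2: "theta_hat V X k ?\<alpha> = real ?\<alpha>"
    unfolding theta_hat_def using ne[of ?\<alpha>] \<alpha> by simp
  have 3: "theta_hat V X k (l + 1) \<le> theta_hat V X k l" if "k \<le> l" "l < ?\<alpha>" for l
  proof -
    have l: "l \<ge> 1" using that \<open>k \<ge> 1\<close> by simp
    \<comment> \<open>The image of \<open>Y\<close> under \<open>tau V X k l\<close> is feasible one
      level down with the same objective, so the supremum there dominates.\<close>
    have "objective V X k (l + 1) Y \<le> theta_hat V X k l"
      if Y: "Y \<in> theta_hat_feasible V X k (l + 1)" for Y
      using cSUP_upper[OF tau_theta_hat_feasible(1)[OF assms(2) l Y]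
          bdd_above_objective_theta_hat[OF assms(2)]]
        tau_theta_hat_feasible(2)[OF assms(2) l Y]
      by (simp add: theta_hat_def)
    then show ?thesis
      unfolding theta_hat_def[of _ _ _ "l + 1"] using ne[of "l + 1"] that by (intro cSUP_least) auto
  qed
  show ?thesis by (intro conjI allI impI) (use 1 2 3 in simp_all)
qed

end
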